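(* If $R=R_1 \times R_2 \times \cdots \times R_n$ is a direct product of finite rings and $x=(x_1,x_2, \ldots, x_n) \in R$, then $\mathrm{Prob}_x(R)=\prod_{i=1}^n\mathrm{Prob}_{x_i}(R_i)$.
   Context: Rings are associative with unity $1$, not necessarily commutative. For a finite ring $R$ and $x \in R$, the multiplication probability is $\mathrm{Prob}_x(R)=\frac{|\{(a,b) \in R^2 : ab=x\}|}{|R|^2}$. *)

theory Defs
  imports Complex_Main "HOL-Algebra.Chinese_Remainder"
begin

definition mult_prob :: "('a, 'm) ring_scheme \<Rightarrow> 'a \<Rightarrow> real"
  where "mult_prob R x =
    real (card {(a, b) \<in> carrier R \<times> carrier R. a \<otimes>\<^bsub>R\<^esub> b = x}) / real (card (carrier R)) ^ 2"

end

theory Submission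
  imports Defs
begin

text \<open>
  The multiplication probability is invariant under ring isomorphisms
  (\<open>mult_prob_ring_iso\<close>), and it is multiplicative on a product of two rings
  (\<open>mult_prob_RDirProd\<close>): since multiplication is componentwise, the pairs with product
  \<open>(x, y)\<close> correspond bijectively to a pair with product \<open>x\<close> together with a pair with
  product \<open>y\<close>. The product of a list of rings is built by iterating the binary product,
  up to the isomorphism \<open>(a, as) \<mapsto> a # as\<close>, starting from the zero ring, in which the
  probability is \<open>1\<close>; induction on the list gives the claim.
\<close>

lemma mult_prob_ring_iso:
  assumes "ring R" and f: "f \<in> ring_iso R S" and x: "x \<in> carrier R"
  shows "mult_prob S (f x) = mult_prob R x"
proof -
  interpret ring R by fact
  have bij: "bij_betw f (carrier R) (carrier S)"
    using f by (simp add: ring_iso_def)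
  have f_mult: "f (a \<otimes>\<^bsub>R\<^esub> b) = f a \<otimes>\<^bsub>S\<^esub> f b" if "a \<in> carrier R" "b \<in> carrier R" for a b
    using f that by (simp add: ring_iso_def ring_hom_def)
  let ?A = "{(a, b) \<in> carrier R \<times> carrier R. a \<otimes>\<^bsub>R\<^esub> b = x}"
  let ?B = "{(a, b) \<in> carrier S \<times> carrier S. a \<otimes>\<^bsub>S\<^esub> b = f x}"
  have inj: "inj_on f (carrier R)" and surj: "f ` carrier R = carrier S"
    using bij by (auto simp: bij_betw_def)
  \<comment> \<open>Closure under multiplication lets injectivity be applied to the equation \<open>f (a \<otimes> b) = f x\<close>.\<close>
  have product_iff: "f a \<otimes>\<^bsub>S\<^esub> f b = f x \<longleftrightarrow> a \<otimes>\<^bsub>R\<^esub> b = x"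
    if "a \<in> carrier R" "b \<in> carrier R" for a b
    using that x inj_on_eq_iff[OF inj m_closed[OF that] x] f_mult[OF that] by metis
  have "map_prod f f ` ?A = ?B"
  proof (intro equalityI subsetI)
    fix q assume "q \<in> ?B"
    then obtain a b where ab: "a \<in> carrier R" "b \<in> carrier R"
      and q: "q = (f a, f b)" and "f a \<otimes>\<^bsub>S\<^esub> f b = f x"
      unfolding surj[symmetric] by blast
    then have "(a, b) \<in> ?A"
      using product_iff[OF ab] by simp
    then show "q \<in> map_prod f f ` ?A"
      unfolding q by (rule rev_image_eqI) simp
  next
    fix q assume "q \<in> map_prod f f ` ?A"
    then obtain a b where ab: "a \<in> carrier R" "b \<in> carrier R"
      and q: "q = (f a, f b)" and "a \<otimes>\<^bsub>R\<^esub> b = x"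
      by auto
    then show "q \<in> ?B"
      unfolding surj[symmetric] using product_iff[OF ab] by simp
  qed
  moreover have "inj_on (map_prod f f) ?A"
    by (rule inj_on_subset[OF map_prod_inj_on[OF inj inj]]) auto
  ultimately have "card ?B = card ?A"
    using card_image[of "map_prod f f" ?A] by (simp only:)
  then show ?thesis
    using bij_betw_same_card[OF bij] by (simp add: mult_prob_def)
qed

text \<open>
  No finiteness is needed: \<open>card (A \<times> B) = card A * card B\<close> holds for all sets, with infinite
  sets counted as \<open>0\<close>, and division by \<open>0\<close> gives \<open>0\<close>.
\<close>

lemma mult_prob_RDirProd:
  "mult_prob (RDirProd R S) (x, y) = mult_prob R x * mult_prob S y"
proof -
  let ?A = "{(a, b) \<in> carrier R \<times> carrier R. a \<otimes>\<^bsub>R\<^esub> b = x}"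
  let ?B = "{(c, d) \<in> carrier S \<times> carrier S. c \<otimes>\<^bsub>S\<^esub> d = y}"
  let ?C = "{(p, q) \<in> carrier (RDirProd R S) \<times> carrier (RDirProd R S).
              p \<otimes>\<^bsub>RDirProd R S\<^esub> q = (x, y)}"
  have "bij_betw (\<lambda>((a, b), (c, d)). ((a, c), (b, d))) (?A \<times> ?B) ?C"
    by (rule bij_betw_byWitness[where f' = "\<lambda>((a, c), (b, d)). ((a, b), (c, d))"])
      (auto simp: RDirProd_def DirProd_def monoid.defs)
  then have "card ?C = card ?A * card ?B"
    using bij_betw_same_card[of _ "?A \<times> ?B" ?C] by (simp only: card_cartesian_product)
  moreover have "card (carrier (RDirProd R S)) = card (carrier R) * card (carrier S)"
    by (simp add: RDirProd_carrier card_cartesian_product)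
  ultimately show ?thesis
    by (simp add: mult_prob_def power_mult_distrib)
qed

lemma mult_prob_nil_ring: "mult_prob nil_ring [] = 1"
proof -
  have "{(a, b) \<in> carrier nil_ring \<times> carrier nil_ring. a \<otimes>\<^bsub>nil_ring\<^esub> b = []} = {([], [])}"
    by (auto simp: monoid.defs)
  then show ?thesis
    by (simp add: mult_prob_def monoid.defs)
qed

theorem lemma2p5:
  fixes Rs :: "(('a, 'm) ring_scheme) list" and x :: "'a list"
  assumes "\<And>i. i < length Rs \<Longrightarrow> ring (Rs ! i)"
    and "\<And>i. i < length Rs \<Longrightarrow> finite (carrier (Rs ! i))"
    and "x \<in> carrier (RDirProd_list Rs)"
  shows "mult_prob (RDirProd_list Rs) x = (\<Prod>i<length Rs. mult_prob (Rs ! i) (x ! i))"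
  using assms(1,3)
proof (induction Rs arbitrary: x)
  case Nil
  then have "x = []"
    by (simp add: monoid.defs)
  then show ?case
    by (simp add: mult_prob_nil_ring)
next
  case (Cons R Rs)
  have "ring R" and rings: "\<And>i. i < length Rs \<Longrightarrow> ring (Rs ! i)"
    using Cons.prems(1)[of 0] Cons.prems(1)[of "Suc i" for i] by auto
  then have prod_ring: "ring (RDirProd R (RDirProd_list Rs))"
    by (intro RDirProd_ring RDirProd_list_is_ring)
  obtain a as where x: "x = a # as" and a: "a \<in> carrier R" and as: "as \<in> carrier (RDirProd_list Rs)"
    using Cons.prems(2) by (auto simp: RDirProd_list_carrier)
  have "mult_prob (RDirProd_list (R # Rs)) x = mult_prob (RDirProd R (RDirProd_list Rs)) (a, as)"
    using mult_prob_ring_iso[OF prod_ring RDirProd_list_iso1, of "(a, as)"] a as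
    by (simp add: x RDirProd_carrier)
  also have "\<dots> = mult_prob R a * (\<Prod>i<length Rs. mult_prob (Rs ! i) (as ! i))"
    by (simp add: mult_prob_RDirProd Cons.IH[OF rings as])
  also have "\<dots> = (\<Prod>i<length (R # Rs). mult_prob ((R # Rs) ! i) (x ! i))"
    by (simp add: x prod.lessThan_Suc_shift del: prod.lessThan_Suc)
  finally show ?case .
qed

end
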